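(* Let $N\in\mathbb{N}$ (not necessarily square-free), let $k>2$ be an integer, and let $\chi$ be a Dirichlet character modulo $N$. Let $\epsilon$ and $\psi$ be primitive Dirichlet characters with conductors $L$ and $M$, respectively, such that $LM\mid N$, $\psi\epsilon=\chi$ and $\psi\epsilon(-1)=(-1)^k$, and let $d$ be a positive divisor of $\frac{N}{LM}$. Let $\alpha,\gamma\in\mathbb{Z}$ with $\gcd(\alpha,\gamma)=1$, and let $\beta,\delta\in\mathbb{Z}$ be such that $\alpha\delta-\beta\gamma=1$; put $R=\begin{bmatrix}\alpha&\beta\\\gamma&\delta\end{bmatrix}\in SL_2(\mathbb{Z})$. Then the constant term $a_0$ of the Fourier expansion of $E_k(Mdz;\epsilon,\psi)$ at the cusp $\alpha/\gamma$ is $$a_0=\left(\frac{\gcd(Md,\gamma)}{Md}\right)^k\sum_{\substack{n=-\infty\\ n\ne0}}^{\infty}\frac{\epsilon\left(\frac{-\gamma}{\gcd(Md,\gamma)}n\right)\psi\left(\frac{Md\,\alpha}{\gcd(Md,\gamma)}n\right)}{n^k}.$$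
   Context: $z$ lies in the upper half plane, and $R(z)=\frac{\alpha z+\beta}{\gamma z+\delta}$. For $k>2$ the (non-normalized) Eisenstein series is $$E_k(Mdz;\epsilon,\psi)=\sum_{\substack{m,n\in\mathbb{Z}\\(m,n)\ne(0,0)}}\frac{\epsilon(m)\psi(n)}{(Mdmz+n)^k},$$ and $E_k(MdR(z);\epsilon,\psi)$ denotes this function evaluated at $R(z)$ in place of $z$. The Fourier expansion at the cusp $\alpha/\gamma$ is the expansion at $\infty$ of $(\gamma z+\delta)^{-k}E_k(MdR(z);\epsilon,\psi)$, and its constant term is $a_0=\lim_{\operatorname{Im}z\to\infty}(\gamma z+\delta)^{-k}E_k(MdR(z);\epsilon,\psi)$. The primitive character of conductor $1$ takes the value $1$ at every integer, including $0$. *)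

theory Defs
  imports "HOL-Analysis.Analysis" "HOL-Number_Theory.Cong"
begin

text \<open>Dirichlet characters modulo N, extended by 0 to the integers not coprime to N. For modulus 1
  every integer (including 0) is coprime to the modulus, so the only character is constantly 1.\<close>

definition dirichlet_character :: "nat \<Rightarrow> (int \<Rightarrow> complex) \<Rightarrow> bool" where
  "dirichlet_character N chi \<longleftrightarrow>
     N > 0 \<and>
     (\<forall>m n. chi (m * n) = chi m * chi n) \<and>
     (\<forall>m n. [m = n] (mod int N) \<longrightarrow> chi m = chi n) \<and>
     (\<forall>n. chi n \<noteq> 0 \<longleftrightarrow> coprime n (int N))"

definition conductor :: "nat \<Rightarrow> (int \<Rightarrow> complex) \<Rightarrow> nat" where
  "conductor N chi =
     (LEAST c. 0 < c \<and> c dvd N \<and>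
        (\<forall>n. coprime n (int N) \<and> [n = 1] (mod int c) \<longrightarrow> chi n = 1))"

definition primitive_character :: "nat \<Rightarrow> (int \<Rightarrow> complex) \<Rightarrow> bool" where
  "primitive_character N chi \<longleftrightarrow> dirichlet_character N chi \<and> conductor N chi = N"

definition eisenstein :: "nat \<Rightarrow> (int \<Rightarrow> complex) \<Rightarrow> (int \<Rightarrow> complex) \<Rightarrow> complex \<Rightarrow> complex" where
  "eisenstein k \<epsilon> \<psi> w =
     (\<Sum>\<^sub>\<infinity>(m, n)\<in>UNIV - {(0, 0)}. \<epsilon> m * \<psi> n / (of_int m * w + of_int n) ^ k)"

definition moebius_transform :: "int \<Rightarrow> int \<Rightarrow> int \<Rightarrow> int \<Rightarrow> complex \<Rightarrow> complex" where
  "moebius_transform \<alpha> \<beta> \<gamma> \<delta> z =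
     (of_int \<alpha> * z + of_int \<beta>) / (of_int \<gamma> * z + of_int \<delta>)"

text \<open>The function f, of weight k on the upper half plane, has constant term c at the cusp
  \<open>\<alpha> / \<gamma>\<close>, computed with respect to the matrix with rows \<open>(\<alpha>, \<beta>)\<close> and \<open>(\<gamma>, \<delta>)\<close>. The limit is
  taken as the imaginary part of z tends to infinity, with no restriction on the real part.\<close>

definition has_cusp_constant_term ::
    "nat \<Rightarrow> (complex \<Rightarrow> complex) \<Rightarrow> int \<Rightarrow> int \<Rightarrow> int \<Rightarrow> int \<Rightarrow> complex \<Rightarrow> bool" where
  "has_cusp_constant_term k f \<alpha> \<beta> \<gamma> \<delta> c \<longleftrightarrow>
     ((\<lambda>z. inverse ((of_int \<gamma> * z + of_int \<delta>) ^ k) * f (moebius_transform \<alpha> \<beta> \<gamma> \<delta> z))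
        \<longlongrightarrow> c) (filtercomap Im at_top)"

end

theory Submission imports Defs begin

text \<open>
  With \<open>A = M d\<close>, multiplying the summand \<open>(m A R(z) + n)^-k\<close> by the automorphy factor
  \<open>(\<gamma> z + \<delta>)^-k\<close> turns it into \<open>(p z + q)^-k\<close>, where
  \<open>p = A \<alpha> m + \<gamma> n\<close> and \<open>q = A \<beta> m + \<delta> n\<close>. So on the upper half plane the transformed
  Eisenstein series is a sum over the nonzero \<open>(p, q)\<close>, with coefficients that are bounded, characters
  being periodic, and that vanish off
  the sublattice of index \<open>A\<close> reached by \<open>(m, n)\<close> (\<open>eisenstein_slash_eq_lattice_sum\<close>).

  As \<open>Im z\<close> grows, every summand with \<open>p \<noteq> 0\<close> tends to 0, and the summands with \<open>p = 0\<close> do not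
  depend on \<open>z\<close>. That the whole part with \<open>p \<noteq> 0\<close> tends to 0, uniformly in \<open>Re z\<close>, rests
  on \<open>k > 2\<close>: three of the factors \<open>\<bar>p z + q\<bar>\<close> can be shared equally between the imaginary part
  \<open>p Im z\<close> and the real part \<open>p Re z + q\<close>, and each exponent \<open>3/2\<close> exceeds 1, so that the
  resulting majorant is summable in \<open>p\<close> and in \<open>q\<close> and carries a factor \<open>(Im z)^(-3/2)\<close>
  (\<open>cusp_term_bound\<close>, \<open>lattice_tail_bound\<close>). Hence the constant term is the sum over
  \<open>p = 0\<close> (\<open>lattice_sum_tendsto\<close>).

  On the row \<open>p = 0\<close> the equation \<open>A \<alpha> m + \<gamma> n = 0\<close> has the solutions
  \<open>m = -(\<gamma>/g) t\<close>, \<open>n = (A \<alpha>/g) t\<close> with \<open>g = gcd A \<gamma>\<close>, because \<open>\<alpha>\<close> and \<open>\<gamma>\<close> are coprime;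
  there \<open>q = (A/g) t\<close>, which gives the factor \<open>(g/A)^k\<close> (\<open>moved_coeff_row\<close>).
\<close>

section \<open>A summable majorant\<close>

definition decay :: "int \<Rightarrow> real" where
  "decay u = (1 + \<bar>of_int u\<bar>) powr (-3/2)"

lemma decay_summable: "decay summable_on UNIV"
proof -
  have "summable (\<lambda>n::nat. real (Suc n) powr (-3/2))"
    using summable_real_powr_iff[of "-3/2"] by (subst summable_Suc_iff) simp
  then have nat_sum: "(\<lambda>n::nat. real (Suc n) powr (-3/2)) summable_on UNIV"
    by (rule summable_nonneg_imp_summable_on) simp
  have pos: "decay summable_on range int"
    by (subst summable_on_reindex) (use nat_sum in \<open>auto simp: o_def decay_def add.commute\<close>)
  have "inj (\<lambda>n. - int n)" by (auto intro: injI)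
  then have neg: "decay summable_on range (\<lambda>n. - int n)"
    by (subst summable_on_reindex) (use nat_sum in \<open>auto simp: o_def decay_def add.commute\<close>)
  have "range int \<union> range (\<lambda>n. - int n) = UNIV"
    by (metis (no_types, lifting) UNIV_eq_I Un_iff int_cases2 rangeI)
  with summable_on_union[OF pos neg] show ?thesis by simp
qed

lemma decay_product_summable: "(\<lambda>(p, q). decay p * decay q) summable_on UNIV"
proof -
  have "(\<lambda>(p, q). decay p * decay q) summable_on UNIV \<times> UNIV"
  proof (rule summable_on_SigmaI)
    show "((\<lambda>q. case (p, q) of (p, q) \<Rightarrow> decay p * decay q) has_sum decay p * infsum decay UNIV) UNIV" for p
      using decay_summable by (simp add: has_sum_cmult_right)
    show "(\<lambda>p. decay p * infsum decay UNIV) summable_on UNIV"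
      using decay_summable by (rule summable_on_cmult_left)
  qed (auto simp: decay_def)
  then show ?thesis by simp
qed

text \<open>The first half of \<open>\<bar>p z + q\<bar>^-3\<close> is estimated by the imaginary part, the second by the real
  part. Shifting \<open>q\<close> by the integer part of \<open>p Re z\<close> makes the estimate independent of \<open>Re z\<close> up to
  a permutation of the \<open>q\<close>. The constant 6 combines \<open>1 + \<bar>p\<bar> \<le> 2 \<bar>p\<bar>\<close> with the 3 in
  \<open>(1 + \<bar>s\<bar>)/3 \<le> max 1 (\<bar>s\<bar> - 1)\<close>, the right-hand side being at most \<open>\<bar>p z + q\<bar>\<close>.\<close>

lemma cusp_term_bound:
  fixes z :: complex and p q :: int and k :: nat
  assumes p: "p \<noteq> 0" and y: "Im z \<ge> 1" and k: "k > 2"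
  shows "norm (1 / (of_int p * z + of_int q) ^ k)
           \<le> 6 powr (3/2) * Im z powr (-3/2) * (decay p * decay (q + \<lfloor>of_int p * Re z\<rfloor>))"
proof -
  define w where "w = of_int p * z + of_int q"
  define s where "s = q + \<lfloor>of_int p * Re z\<rfloor>"
  define P where "P = (1 + \<bar>real_of_int p\<bar>) / 2"
  define S where "S = (1 + \<bar>real_of_int s\<bar>) / 3"
  have p1: "\<bar>real_of_int p\<bar> \<ge> 1" using p by linarith
  have im: "\<bar>real_of_int p\<bar> * Im z \<le> norm w"
    using abs_Im_le_cmod[of w] y by (simp add: w_def abs_mult)
  have "P * Im z \<le> \<bar>real_of_int p\<bar> * Im z"
    using p1 y by (intro mult_right_mono) (auto simp: P_def)
  with im have 1: "P * Im z \<le> norm w" by linarith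
  have "1 * 1 \<le> \<bar>real_of_int p\<bar> * Im z" using p1 y by (intro mult_mono) auto
  with im have w1: "1 \<le> norm w" by linarith
  have "\<bar>of_int p * Re z + of_int q\<bar> \<le> norm w"
    using abs_Re_le_cmod[of w] by (simp add: w_def)
  moreover have "of_int s \<le> of_int p * Re z + of_int q" "of_int p * Re z + of_int q < of_int s + 1"
    unfolding s_def by linarith+
  ultimately have "\<bar>real_of_int s\<bar> - 1 \<le> norm w" by linarith
  with w1 have 2: "S \<le> norm w" unfolding S_def by (cases "\<bar>real_of_int s\<bar> \<le> 2") simp_all
  have pos: "P > 0" "S > 0" by (auto simp: P_def S_def)
  have "norm (1 / w ^ k) = 1 / norm w ^ k" by (simp add: norm_divide norm_power)
  also have "\<dots> \<le> 1 / norm w ^ 3"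
    using w1 k by (intro divide_left_mono power_increasing mult_pos_pos zero_less_power) auto
  also have "\<dots> = norm w powr (-3)"
    using w1 by (simp add: powr_minus_divide powr_numeral)
  also have "\<dots> = norm w powr (-3/2) * norm w powr (-3/2)"
    by (simp flip: powr_add)
  also have "\<dots> \<le> (P * Im z) powr (-3/2) * S powr (-3/2)"
    using 1 2 pos y by (intro mult_mono powr_mono2') auto
  also have "\<dots> = 6 powr (3/2) * Im z powr (-3/2) * (decay p * decay s)"
  proof -
    have "(6::real) powr (3/2) = 2 powr (3/2) * 3 powr (3/2)"
      by (simp flip: powr_mult)
    then show ?thesis using y
      by (simp add: P_def S_def decay_def powr_mult powr_divide powr_minus_divide)
  qed
  finally show ?thesis by (simp add: w_def s_def)
qed

section \<open>Lattice sums near the cusp at infinity\<close>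

text \<open>The shift \<open>h\<close> depends on \<open>z\<close> but is injective, so the sum of the shifted majorant never
  exceeds the full sum \<open>K\<close>; this is the source of the uniformity in \<open>Re z\<close>.\<close>

lemma lattice_tail:
  fixes c :: "int \<times> int \<Rightarrow> complex" and k :: nat
  assumes c: "\<And>x. norm (c x) \<le> B" and k: "k > 2" and y: "Im z \<ge> 1"
  defines "T \<equiv> {(p, q). p \<noteq> (0::int)}"
    and "t \<equiv> \<lambda>(p, q). c (p, q) / (of_int p * z + of_int q) ^ k"
    and "K \<equiv> \<Sum>\<^sub>\<infinity>(p, q)\<in>UNIV. decay p * decay q"
  shows lattice_tail_summable: "t summable_on T"
    and lattice_tail_bound: "norm (infsum t T) \<le> B * 6 powr (3/2) * K * Im z powr (-3/2)"
proof -
  define D where "D = (\<lambda>(p, q). decay p * decay q)"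
  define h where "h = (\<lambda>(p, q). (p, q + \<lfloor>of_int p * Re z\<rfloor>))"
  define C where "C = B * 6 powr (3/2) * Im z powr (-3/2)"
  have B: "B \<ge> 0" using c[of undefined] norm_ge_zero order_trans by blast
  have inj: "inj_on h T" by (auto simp: inj_on_def h_def)
  have D: "D summable_on X" for X
    using decay_product_summable summable_on_subset unfolding D_def by blast
  have Dh: "(D \<circ> h) summable_on T"
    using D inj by (simp flip: summable_on_reindex)
  have le: "norm (t x) \<le> C * (D \<circ> h) x" if "x \<in> T" for x
  proof -
    obtain p q where x: "x = (p, q)" by force
    have "norm (t x) = norm (c x) * norm (1 / (of_int p * z + of_int q) ^ k)"
      by (simp add: t_def x norm_divide)
    also have "\<dots> \<le> B * (6 powr (3/2) * Im z powr (-3/2) * (D \<circ> h) x)"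
      using cusp_term_bound[of p z k q] that y k c[of x] B
      by (intro mult_mono) (auto simp: T_def x D_def h_def)
    finally show ?thesis by (simp add: C_def mult.assoc)
  qed
  have maj: "(\<lambda>x. C * (D \<circ> h) x) summable_on T"
    using Dh by (rule summable_on_cmult_right)
  show t: "t summable_on T"
    using Infinite_Sum.abs_summable_on_comparison_test'[OF maj le] by (rule Infinite_Sum.abs_summable_summable)
  have "norm (infsum t T) \<le> (\<Sum>\<^sub>\<infinity>x\<in>T. C * (D \<circ> h) x)"
    using t maj le by (intro norm_infsum_le[OF has_sum_infsum has_sum_infsum])
  also have "\<dots> = C * infsum D (h ` T)"
    by (simp only: infsum_cmult_right' infsum_reindex[OF inj])
  also have "\<dots> \<le> C * K"
  proof (rule mult_left_mono)
    show "infsum D (h ` T) \<le> K"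
      unfolding K_def D_def[symmetric] using D
      by (intro infsum_mono2) (auto simp: D_def decay_def)
  qed (use B in \<open>simp add: C_def\<close>)
  finally show "norm (infsum t T) \<le> B * 6 powr (3/2) * K * Im z powr (-3/2)"
    by (simp add: C_def mult_ac)
qed

text \<open>Needed to split the row \<open>p = 0\<close> off the lattice sum, since \<open>infsum\<close> is 0 by convention for
  families that are not summable.\<close>

lemma row_summable:
  fixes c :: "int \<Rightarrow> complex" and k :: nat
  assumes c: "\<And>q. norm (c q) \<le> B" and k: "k > 2"
  shows "(\<lambda>q. c q / of_int q ^ k) summable_on UNIV - {0}"
proof (rule Infinite_Sum.abs_summable_summable, rule Infinite_Sum.abs_summable_on_comparison_test')
  show "(\<lambda>q. B * 2 powr (3/2) * decay q) summable_on UNIV - {0}"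
    using summable_on_subset[OF decay_summable] by (intro summable_on_cmult_right) auto
  show "norm (c q / of_int q ^ k) \<le> B * 2 powr (3/2) * decay q" if "q \<in> UNIV - {0}" for q
  proof -
    have q: "\<bar>real_of_int q\<bar> \<ge> 1" using that by auto
    have "1 / \<bar>real_of_int q\<bar> ^ k \<le> 1 / \<bar>real_of_int q\<bar> ^ 3"
      using q k by (intro divide_left_mono power_increasing mult_pos_pos zero_less_power) auto
    also have "\<dots> = \<bar>real_of_int q\<bar> powr (-3)"
      using q by (simp add: powr_minus_divide powr_numeral)
    also have "\<dots> \<le> \<bar>real_of_int q\<bar> powr (-3/2)"
      using q by (intro powr_mono) auto
    also have "\<dots> \<le> ((1 + \<bar>real_of_int q\<bar>) / 2) powr (-3/2)"
      using q by (intro powr_mono2') auto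
    also have "\<dots> = 2 powr (3/2) * decay q"
      by (simp add: decay_def powr_divide powr_minus_divide)
    finally have "norm (c q) * (1 / \<bar>real_of_int q\<bar> ^ k) \<le> B * (2 powr (3/2) * decay q)"
      using c[of q] by (intro mult_mono) (auto intro: order_trans[OF norm_ge_zero])
    then show ?thesis by (simp add: norm_divide norm_power)
  qed
qed

lemma lattice_sum_tendsto:
  fixes c :: "int \<times> int \<Rightarrow> complex" and k :: nat
  assumes c: "\<And>x. norm (c x) \<le> B" and k: "k > 2"
  shows "((\<lambda>z. \<Sum>\<^sub>\<infinity>(p, q)\<in>UNIV - {(0, 0)}. c (p, q) / (of_int p * z + of_int q) ^ k)
           \<longlongrightarrow> (\<Sum>\<^sub>\<infinity>q\<in>UNIV - {0}. c (0, q) / of_int q ^ k)) (filtercomap Im at_top)"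
proof -
  define T where "T = {(p :: int, q :: int). p \<noteq> 0}"
  define t where "t = (\<lambda>z (p, q). c (p, q) / (of_int p * z + of_int q) ^ k)"
  define row where "row = (\<Sum>\<^sub>\<infinity>q\<in>UNIV - {0}. c (0, q) / of_int q ^ k)"
  define K where "K = B * 6 powr (3/2) * (\<Sum>\<^sub>\<infinity>(p, q)\<in>UNIV. decay p * decay q)"
  have split: "infsum (t z) (UNIV - {(0, 0)}) = row + infsum (t z) T" if "Im z \<ge> 1" for z
  proof -
    have inj: "inj_on (Pair 0) X" for X :: "int set" by (auto simp: inj_on_def)
    have dec: "UNIV - {(0, 0)} = Pair 0 ` (UNIV - {0}) \<union> T"
      by (auto simp: T_def)
    have eq: "t z \<circ> Pair 0 = (\<lambda>q. c (0, q) / of_int q ^ k)"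
      by (auto simp: t_def)
    have "t z summable_on Pair 0 ` (UNIV - {0})"
      using row_summable[of "\<lambda>q. c (0, q)" B k] c k by (simp add: summable_on_reindex[OF inj] eq)
    moreover have "t z summable_on T"
      using lattice_tail_summable[of c B k z] c k that by (simp add: T_def t_def)
    ultimately have "infsum (t z) (UNIV - {(0, 0)})
        = infsum (t z) (Pair 0 ` (UNIV - {0})) + infsum (t z) T"
      unfolding dec by (intro infsum_Un_disjoint) (auto simp: T_def)
    also have "infsum (t z) (Pair 0 ` (UNIV - {0})) = row"
      by (simp add: infsum_reindex[OF inj] eq row_def)
    finally show ?thesis .
  qed
  have big: "eventually (\<lambda>z. Im z \<ge> 1) (filtercomap Im at_top)"
    using eventually_ge_at_top by (rule eventually_filtercomapI)
  have "((\<lambda>z. infsum (t z) T) \<longlongrightarrow> 0) (filtercomap Im at_top)"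
  proof (rule Lim_null_comparison)
    show "eventually (\<lambda>z. norm (infsum (t z) T) \<le> K * Im z powr (-3/2)) (filtercomap Im at_top)"
      using big
    proof eventually_elim
      case (elim z)
      then show ?case
        using lattice_tail_bound[of c B k z] c k by (simp add: T_def t_def K_def)
    qed
    have "((\<lambda>y::real. y powr (-3/2)) \<longlongrightarrow> 0) at_top"
      by (rule tendsto_neg_powr) (auto intro: filterlim_ident)
    then have "((\<lambda>z. Im z powr (-3/2)) \<longlongrightarrow> 0) (filtercomap Im at_top)"
      by (rule filterlim_compose) (rule filterlim_filtercomap)
    then show "((\<lambda>z. K * Im z powr (-3/2)) \<longlongrightarrow> 0) (filtercomap Im at_top)"
      by (rule tendsto_mult_right_zero)
  qed
  then have "((\<lambda>z. row + infsum (t z) T) \<longlongrightarrow> row + 0) (filtercomap Im at_top)"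
    by (intro tendsto_add tendsto_const)
  moreover have "eventually (\<lambda>z. row + infsum (t z) T = infsum (t z) (UNIV - {(0, 0)})) (filtercomap Im at_top)"
    using big by eventually_elim (simp add: split)
  ultimately have "((\<lambda>z. infsum (t z) (UNIV - {(0, 0)})) \<longlongrightarrow> row) (filtercomap Im at_top)"
    using Lim_transform_eventually by fastforce
  then show ?thesis by (simp add: t_def row_def)
qed

lemma dirichlet_character_bounded:
  assumes "dirichlet_character N chi"
  obtains B where "\<And>n. norm (chi n) \<le> B"
proof -
  have N: "N > 0" and per: "\<And>m n. [m = n] (mod int N) \<Longrightarrow> chi m = chi n"
    using assms by (auto simp: dirichlet_character_def)
  have "chi n \<in> chi ` {0..<int N}" for n
    using per[of n "n mod int N"] N by (auto simp: cong_def)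
  then have "range chi \<subseteq> chi ` {0..<int N}" by auto
  then have "bounded (range chi)"
    using finite_imp_bounded finite_subset by blast
  then show ?thesis
    using that by (auto simp: bounded_iff)
qed

section \<open>The Eisenstein series in the moved coordinates\<close>

text \<open>The coefficient \<open>\<epsilon> m * \<psi> n\<close> in terms of \<open>p = A \<alpha> m + \<gamma> n\<close> and \<open>q = A \<beta> m + \<delta> n\<close>: for
  \<open>\<alpha> \<delta> - \<beta> \<gamma> = 1\<close> this system is solved by \<open>A m = \<delta> p - \<gamma> q\<close> and \<open>n = \<alpha> q - \<beta> p\<close>. Extending by
  0 where \<open>m\<close> would not be an integer allows one to sum over all pairs.\<close>

definition moved_coeff ::
    "int \<Rightarrow> (int \<Rightarrow> complex) \<Rightarrow> (int \<Rightarrow> complex) \<Rightarrow> int \<Rightarrow> int \<Rightarrow> int \<Rightarrow> int \<Rightarrow> int \<times> int \<Rightarrow> complex" where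
  "moved_coeff A \<epsilon> \<psi> \<alpha> \<beta> \<gamma> \<delta> = (\<lambda>(p, q).
     if A dvd \<delta> * p - \<gamma> * q then \<epsilon> ((\<delta> * p - \<gamma> * q) div A) * \<psi> (\<alpha> * q - \<beta> * p) else 0)"

text \<open>The map \<open>(m, n) \<mapsto> (p, q)\<close> has determinant \<open>A\<close>, hence is injective and preserves nonzero
  pairs, and the moved coefficients vanish off its image. Both sides are compared term by term, so
  the identity also holds, as \<open>0 = 0\<close>, where the series are not summable.\<close>

lemma eisenstein_slash_eq_lattice_sum:
  fixes A \<alpha> \<beta> \<gamma> \<delta> :: int and z :: complex
  assumes A: "A > 0" and det: "\<alpha> * \<delta> - \<beta> * \<gamma> = 1" and z: "Im z > 0"
  shows "inverse ((of_int \<gamma> * z + of_int \<delta>) ^ k) *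
           eisenstein k \<epsilon> \<psi> (of_int A * moebius_transform \<alpha> \<beta> \<gamma> \<delta> z)
         = (\<Sum>\<^sub>\<infinity>(p, q)\<in>UNIV - {(0, 0)}.
              moved_coeff A \<epsilon> \<psi> \<alpha> \<beta> \<gamma> \<delta> (p, q) / (of_int p * z + of_int q) ^ k)"
    (is "?l = infsum ?g _")
proof -
  define j where "j = of_int \<gamma> * z + of_int \<delta>"
  define \<Phi> where "\<Phi> = (\<lambda>(m, n). (A * \<alpha> * m + \<gamma> * n, A * \<beta> * m + \<delta> * n))"
  define U where "U = UNIV - {(0::int, 0::int)}"
  have j: "j \<noteq> 0"
  proof
    assume "j = 0"
    then have "Im j = 0" "Re j = 0" by auto
    with z have "\<gamma> = 0" "\<delta> = 0" by (auto simp: j_def)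
    with det show False by simp
  qed
  have inv1: "\<delta> * (A * \<alpha> * m + \<gamma> * n) - \<gamma> * (A * \<beta> * m + \<delta> * n) = A * m" for m n
  proof -
    have "\<delta> * (A * \<alpha> * m + \<gamma> * n) - \<gamma> * (A * \<beta> * m + \<delta> * n) = A * m * (\<alpha> * \<delta> - \<beta> * \<gamma>)"
      by (simp add: algebra_simps)
    with det show ?thesis by simp
  qed
  have inv2: "\<alpha> * (A * \<beta> * m + \<delta> * n) - \<beta> * (A * \<alpha> * m + \<gamma> * n) = n" for m n
  proof -
    have "\<alpha> * (A * \<beta> * m + \<delta> * n) - \<beta> * (A * \<alpha> * m + \<gamma> * n) = n * (\<alpha> * \<delta> - \<beta> * \<gamma>)"
      by (simp add: algebra_simps)
    with det show ?thesis by simp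
  qed
  have inj: "inj \<Phi>"
  proof (rule injI)
    fix x y assume eq: "\<Phi> x = \<Phi> y"
    obtain m n m' n' where xy: "x = (m, n)" "y = (m', n')" by force
    have "A * m = A * m'" "n = n'"
      using eq inv1[of m n] inv1[of m' n'] inv2[of m n] inv2[of m' n'] by (auto simp: xy \<Phi>_def)
    with A xy show "x = y" by simp
  qed
  have \<Phi>0: "\<Phi> (0, 0) = (0, 0)" by (simp add: \<Phi>_def)
  have term_eq: "(?g \<circ> \<Phi>) x = inverse (j ^ k) *
      (case x of (m, n) \<Rightarrow> \<epsilon> m * \<psi> n / (of_int m * (of_int A * moebius_transform \<alpha> \<beta> \<gamma> \<delta> z) + of_int n) ^ k)" for x
  proof -
    obtain m n where x: "x = (m, n)" by force
    have "of_int (A * \<alpha> * m + \<gamma> * n) * z + of_int (A * \<beta> * m + \<delta> * n)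
        = j * (of_int m * (of_int A * moebius_transform \<alpha> \<beta> \<gamma> \<delta> z) + of_int n)"
      using j unfolding moebius_transform_def j_def[symmetric]
      by (simp add: field_simps) (simp add: j_def algebra_simps)
    then show ?thesis using A
      unfolding x \<Phi>_def o_def prod.case moved_coeff_def inv1 inv2
      by (simp add: power_mult_distrib divide_inverse mult_ac)
  qed
  have "?l = infsum (?g \<circ> \<Phi>) U"
    unfolding term_eq[abs_def] infsum_cmult_right' eisenstein_def U_def j_def by simp
  also have "\<dots> = infsum ?g (\<Phi> ` U)"
    using inj by (subst infsum_reindex) (auto intro: inj_on_subset)
  also have "\<dots> = infsum ?g U"
  proof (rule infsum_cong_neutral)
    fix x assume x: "x \<in> U - \<Phi> ` U"
    obtain p q where pq: "x = (p, q)" by force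
    have "\<not> A dvd \<delta> * p - \<gamma> * q"
    proof
      assume "A dvd \<delta> * p - \<gamma> * q"
      then obtain m where m: "\<delta> * p - \<gamma> * q = A * m" by auto
      define n where "n = \<alpha> * q - \<beta> * p"
      have "A * \<alpha> * m + \<gamma> * n = \<alpha> * (\<delta> * p - \<gamma> * q) + \<gamma> * n" by (simp add: m)
      also have "\<dots> = p * (\<alpha> * \<delta> - \<beta> * \<gamma>)" by (simp add: n_def algebra_simps)
      finally have 1: "A * \<alpha> * m + \<gamma> * n = p" using det by simp
      have "A * \<beta> * m + \<delta> * n = \<beta> * (\<delta> * p - \<gamma> * q) + \<delta> * n" by (simp add: m)
      also have "\<dots> = q * (\<alpha> * \<delta> - \<beta> * \<gamma>)" by (simp add: n_def algebra_simps)
      finally have "A * \<beta> * m + \<delta> * n = q" using det by simp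
      with 1 have "\<Phi> (m, n) = x" by (simp add: \<Phi>_def pq)
      with x \<Phi>0 show False by (auto simp: U_def)
    qed
    then show "?g x = 0" by (simp add: pq moved_coeff_def)
  next
    fix x assume "x \<in> \<Phi> ` U - U"
    then obtain y where "y \<in> U" "\<Phi> y = \<Phi> (0, 0)" unfolding U_def \<Phi>0 by blast
    with inj have "(0, 0) \<in> U" by (metis injD)
    then show "?g x = 0" by (simp add: U_def)
  qed simp
  finally show ?thesis by (simp add: U_def)
qed

text \<open>The coefficient at \<open>(0, q)\<close> vanishes unless \<open>A\<close> divides \<open>\<gamma> q\<close>, that is, unless \<open>q\<close> is a
  multiple of \<open>A/g\<close>; substituting \<open>q = (A/g) n\<close> gives the right-hand side.\<close>

lemma moved_coeff_row:
  fixes A \<gamma> :: int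
  assumes A: "A > 0"
  defines "g \<equiv> gcd A \<gamma>"
  shows "(\<Sum>\<^sub>\<infinity>q\<in>UNIV - {0}. moved_coeff A \<epsilon> \<psi> \<alpha> \<beta> \<gamma> \<delta> (0, q) / of_int q ^ k)
       = (of_int g / of_int A) ^ k *
         (\<Sum>\<^sub>\<infinity>n\<in>UNIV - {0}. \<epsilon> ((- \<gamma>) div g * n) * \<psi> ((A * \<alpha>) div g * n) / of_int n ^ k)"
    (is "infsum ?f _ = ?c * infsum ?h _")
proof -
  have g: "g > 0" using A by (simp add: g_def)
  obtain a c where a: "A = g * a" and c: "\<gamma> = g * c" by (metis dvd_def g_def gcd_dvd1 gcd_dvd2)
  have a0: "a > 0" using A g a by (simp add: zero_less_mult_iff)
  have "coprime a c"
    using A g a c by (metis g_def div_gcd_coprime less_irrefl nonzero_mult_div_cancel_left)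
  then have dvd_iff: "A dvd \<gamma> * q \<longleftrightarrow> a dvd q" for q
    using g unfolding a c by (simp add: mult.assoc coprime_dvd_mult_right_iff)
  have inj: "inj_on ((*) a) X" for X using a0 by (auto simp: inj_on_def)
  have term_eq: "(?f \<circ> (*) a) n = ?c * ?h n" for n
  proof -
    have "\<delta> * 0 - \<gamma> * (a * n) = A * (- c * n)" by (simp add: a c)
    then have 1: "(\<delta> * 0 - \<gamma> * (a * n)) div A = - c * n"
      using A by (metis less_irrefl nonzero_mult_div_cancel_left)
    have 2: "(- \<gamma>) div g = - c" "(A * \<alpha>) div g = a * \<alpha>"
      using g by (simp_all add: a c mult.assoc minus_mult_right del: mult_minus_right)
    have "?c = 1 / of_int a ^ k" using g by (simp add: a power_divide power_mult_distrib)
    moreover have "moved_coeff A \<epsilon> \<psi> \<alpha> \<beta> \<gamma> \<delta> (0, a * n) = \<epsilon> (- c * n) * \<psi> (a * \<alpha> * n)"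
      unfolding moved_coeff_def prod.case 1 by (simp add: dvd_iff mult_ac)
    ultimately show ?thesis by (simp add: 2 power_mult_distrib)
  qed
  have "infsum ?f (UNIV - {0}) = infsum ?f ((*) a ` (UNIV - {0}))"
    by (rule infsum_cong_neutral) (use a0 in \<open>auto simp: moved_coeff_def dvd_iff elim!: dvdE\<close>)
  also have "\<dots> = infsum (\<lambda>n. ?c * ?h n) (UNIV - {0})"
    by (simp only: infsum_reindex[OF inj] term_eq[abs_def])
  finally show ?thesis by (simp only: infsum_cmult_right')
qed

theorem mainTheorem10:
  fixes N L M d k :: nat
    and chi \<epsilon> \<psi> :: "int \<Rightarrow> complex"
    and \<alpha> \<beta> \<gamma> \<delta> :: int
  assumes "N > 0"
    and "k > 2"
    and "dirichlet_character N chi"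
    and "primitive_character L \<epsilon>"
    and "primitive_character M \<psi>"
    and "L * M dvd N"
    and "\<And>n. coprime n (int N) \<Longrightarrow> \<psi> n * \<epsilon> n = chi n"
    and "\<psi> (-1) * \<epsilon> (-1) = (-1) ^ k"
    and "d > 0"
    and "d dvd N div (L * M)"
    and "coprime \<alpha> \<gamma>"
    and "\<alpha> * \<delta> - \<beta> * \<gamma> = 1"
  shows "has_cusp_constant_term k (\<lambda>z. eisenstein k \<epsilon> \<psi> (of_nat (M * d) * z)) \<alpha> \<beta> \<gamma> \<delta>
           ((of_int (gcd (int (M * d)) \<gamma>) / of_nat (M * d)) ^ k *
            (\<Sum>\<^sub>\<infinity>n\<in>UNIV - {0}.
               \<epsilon> ((- \<gamma>) div gcd (int (M * d)) \<gamma> * n) *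
               \<psi> ((int (M * d) * \<alpha>) div gcd (int (M * d)) \<gamma> * n) / of_int n ^ k))"
proof -
  define A where "A = int (M * d)"
  define c where "c = moved_coeff A \<epsilon> \<psi> \<alpha> \<beta> \<gamma> \<delta>"
  have chars: "dirichlet_character L \<epsilon>" "dirichlet_character M \<psi>"
    using assms(4,5) by (auto simp: primitive_character_def)
  have A: "A > 0" using chars assms(9) by (simp add: A_def dirichlet_character_def)
  obtain B1 B2 where B: "\<And>n. norm (\<epsilon> n) \<le> B1" "\<And>n. norm (\<psi> n) \<le> B2"
    using dirichlet_character_bounded chars by metis
  then have nonneg: "0 \<le> B1" "0 \<le> B2" using norm_ge_zero order_trans by blast+
  have "norm (c x) \<le> B1 * B2" for x
    using B nonneg by (auto simp: c_def moved_coeff_def norm_mult split: prod.split intro!: mult_mono)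
  from lattice_sum_tendsto[OF this assms(2)]
  have lim: "((\<lambda>z. \<Sum>\<^sub>\<infinity>(p, q)\<in>UNIV - {(0, 0)}. c (p, q) / (of_int p * z + of_int q) ^ k)
      \<longlongrightarrow> (\<Sum>\<^sub>\<infinity>q\<in>UNIV - {0}. c (0, q) / of_int q ^ k)) (filtercomap Im at_top)" .
  have "eventually (\<lambda>z. Im z > 0) (filtercomap Im at_top)"
    using eventually_gt_at_top by (rule eventually_filtercomapI)
  then have "eventually (\<lambda>z. (\<Sum>\<^sub>\<infinity>(p, q)\<in>UNIV - {(0, 0)}. c (p, q) / (of_int p * z + of_int q) ^ k)
      = inverse ((of_int \<gamma> * z + of_int \<delta>) ^ k) *
        eisenstein k \<epsilon> \<psi> (of_int A * moebius_transform \<alpha> \<beta> \<gamma> \<delta> z)) (filtercomap Im at_top)"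
    by eventually_elim (simp add: eisenstein_slash_eq_lattice_sum[OF A assms(12)] c_def)
  from Lim_transform_eventually[OF lim this] show ?thesis
    unfolding has_cusp_constant_term_def c_def moved_coeff_row[OF A] by (simp add: A_def)
qed

end
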